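(* Let $N\ge u\ge1$ be real numbers with $N>1$, and let $A\subseteq\{1,\dots,\lfloor N/u\rfloor\}$ be such that $$\sum_{a\in A}\frac1a\ >\ \frac1u+\frac1{\sqrt N-1}.$$ Then there exist a positive integer $k$ and (not necessarily distinct) elements $a_1,\dots,a_k\in A$ such that $N-k<a_1+\dots+a_k\le N$. *)

theory Defs
  imports Complex_Main
begin

end

theory Submission
  imports Defs "HOL-Analysis.Analysis" "HOL-Library.Multiset"
begin

text \<open>
  If the conclusion fails, then for every multiset over \<open>A\<close> either the sum of the \<open>a + 1\<close> is at
  most \<open>N\<close> or the sum of the \<open>a\<close> exceeds \<open>N\<close>. This is the discrete form of the situation of
  Bleichenbacher's theorem: the additive semigroup generated by the disjoint intervals
  \<open>(a, a + 1)\<close> misses \<open>N\<close>.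

  For disjoint intervals \<open>(\<alpha> b, b)\<close> with this property for a bound \<open>c\<close>, the sum of
  \<open>ln (b / \<alpha> b)\<close> is at most \<open>D / c\<close>, where \<open>D\<close> bounds the right endpoints. To see this, fix the
  right endpoints and move the left endpoints so as to maximise the sum. If two intervals touch
  at the optimum, merge them and use induction. Otherwise let \<open>\<Delta> b\<close> be the distance from \<open>b\<close> to
  the preceding right endpoint and \<open>v b = (b - \<alpha> b) - \<alpha> b * \<Delta> b / c\<close>. If a multiset \<open>M\<close> is tight,
  i.e. its left endpoints add up to \<open>c\<close>, then replacing one \<open>b\<close> in it by its predecessor brings
  that sum below \<open>c\<close>, hence the sum of the right endpoints to at most \<open>c\<close>. So the lengths in \<open>M\<close>
  add up to at most \<open>\<Delta> b\<close> for each \<open>b\<close> in \<open>M\<close>, and averaging with weights \<open>\<alpha> b / c\<close> shows that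
  the sum of \<open>v\<close> over \<open>M\<close> is at most \<open>0\<close>. Thus \<open>\<alpha>\<close> may be moved in direction \<open>- v\<close>, and optimality
  forces the sum of \<open>v b / \<alpha> b\<close> to be at most \<open>0\<close>, which gives the claim since the \<open>\<Delta> b\<close> add up
  to at most \<open>D\<close> and \<open>ln (b / \<alpha> b) \<le> (b - \<alpha> b) / \<alpha> b\<close>.
\<close>

section \<open>Gap systems and the gaps between right endpoints\<close>

text \<open>Intervals are indexed by their right endpoints, which stay fixed while
  \<open>\<alpha>\<close> varies. Apart from positivity, all conditions on \<open>\<alpha>\<close>
  are weak inequalities and so survive limits; empty and touching intervals are therefore
  allowed.\<close>

definition gap_system :: "real \<Rightarrow> real set \<Rightarrow> (real \<Rightarrow> real) \<Rightarrow> bool" where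
  "gap_system c J \<alpha> \<longleftrightarrow>
     (\<forall>b\<in>J. 0 < \<alpha> b \<and> \<alpha> b \<le> b) \<and>
     (\<forall>b\<in>J. \<forall>b'\<in>J. b' < b \<longrightarrow> b' \<le> \<alpha> b) \<and>
     (\<forall>M. set_mset M \<subseteq> J \<longrightarrow> c < (\<Sum>b\<in>#M. b) \<longrightarrow> c \<le> (\<Sum>b\<in>#M. \<alpha> b))"

text \<open>The default 0 below the least element lets the differences
  \<open>b - pred_in J b\<close> telescope from 0.\<close>

definition pred_in :: "real set \<Rightarrow> real \<Rightarrow> real" where
  "pred_in J b = Max (insert 0 {b'\<in>J. b' < b})"

lemma gap_system_subset:
  assumes "gap_system c J \<alpha>" "J' \<subseteq> J"
  shows "gap_system c J' \<alpha>"
  using assms unfolding gap_system_def by (meson order_trans subsetD)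

lemma sum_mset_strict_mono_on:
  fixes f g :: "'a \<Rightarrow> real"
  assumes "\<And>x. x \<in># M \<Longrightarrow> f x < g x" "M \<noteq> {#}"
  shows "(\<Sum>x\<in>#M. f x) < (\<Sum>x\<in>#M. g x)"
  using assms
proof (induction M)
  case (add x M)
  then show ?case by (cases "M = {#}") (auto intro: add_strict_mono)
qed simp

text \<open>Adding the elements in increasing order, the gaps telescope to the largest one, or to 0
  if \<open>J\<close> is empty.\<close>

lemma sum_gaps_le:
  assumes "finite J" "\<And>b. b \<in> J \<Longrightarrow> 0 < b" "\<And>b. b \<in> J \<Longrightarrow> b \<le> D" "0 \<le> D"
  shows "(\<Sum>b\<in>J. b - pred_in J b) \<le> D"
proof -
  have "(\<Sum>b\<in>J. b - pred_in J b) = Max (insert 0 J)"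
    using assms(1,2)
  proof (induction J rule: finite_linorder_max_induct)
    case empty
    then show ?case by simp
  next
    case (insert b A)
    have "b \<notin> A" using insert by auto
    have pb: "pred_in (insert b A) b = Max (insert 0 A)"
    proof -
      have "{b' \<in> insert b A. b' < b} = A" using insert by auto
      then show ?thesis by (simp add: pred_in_def)
    qed
    have pa: "pred_in (insert b A) a = pred_in A a" if "a \<in> A" for a
    proof -
      have "{b' \<in> insert b A. b' < a} = {b' \<in> A. b' < a}" using insert that by force
      then show ?thesis by (simp add: pred_in_def)
    qed
    have "Max (insert 0 (insert b A)) = b"
      using insert by (intro Max_eqI) (auto intro: less_imp_le)
    moreover have "(\<Sum>a\<in>insert b A. a - pred_in (insert b A) a)
        = (b - Max (insert 0 A)) + (\<Sum>a\<in>A. a - pred_in A a)"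
      using \<open>b \<notin> A\<close> insert.hyps(1) by (simp add: pb pa)
    ultimately show ?case using insert by simp
  qed
  also have "\<dots> \<le> D" using assms by simp
  finally show ?thesis .
qed

section \<open>Merging touching intervals\<close>

text \<open>
  A multiset containing the merged interval is treated by exchanging its copies of \<open>b\<close> for \<open>b'\<close> one
  at a time: the right endpoints after an exchange dominate the left endpoints before it.
\<close>

lemma gap_system_merge:
  assumes sys: "gap_system c J \<alpha>"
    and lt: "\<And>d. d \<in> J \<Longrightarrow> \<alpha> d < d"
    and le: "\<And>d. d \<in> J \<Longrightarrow> d \<le> c"
    and b: "b \<in> J" and b': "b' \<in> J" and eq: "\<alpha> b = b'"
  shows "gap_system c (J - {b'}) (\<alpha>(b := \<alpha> b'))"
proof -
  let ?\<alpha> = "\<alpha>(b := \<alpha> b')"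
  have bb: "b' < b" using lt[OF b] eq by simp
  have pos: "0 < \<alpha> d" if "d \<in> J" for d using sys that by (auto simp: gap_system_def)
  have sep: "d' \<le> \<alpha> d" if "d \<in> J" "d' \<in> J" "d' < d" for d d'
    using sys that by (auto simp: gap_system_def)
  have avoid: "c \<le> (\<Sum>d\<in>#M. \<alpha> d)" if "set_mset M \<subseteq> J" "c < (\<Sum>d\<in>#M. d)" for M
    using sys that by (auto simp: gap_system_def)
  have merged: "c \<le> (\<Sum>d\<in>#M. ?\<alpha> d)" if M: "set_mset M \<subseteq> J - {b'}" "c < (\<Sum>d\<in>#M. d)" for M
  proof -
    define m where "m = count M b"
    define R where "R = filter_mset (\<lambda>d. d \<noteq> b) M"
    have split: "M = R + replicate_mset m b"
      unfolding R_def m_def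
      by (rule multiset_eqI) (auto simp: count_replicate_mset)
    have RJ: "set_mset R \<subseteq> J" and Rb: "b \<notin># R" using M(1) by (auto simp: R_def)
    have step: "c \<le> (\<Sum>d\<in>#R + replicate_mset (m - j) b + replicate_mset j b'. \<alpha> d)" if "j \<le> m" for j
      using that
    proof (induction j)
      case 0
      then show ?case using avoid[of M] M split by auto
    next
      case (Suc j)
      let ?L = "R + replicate_mset (m - Suc j) b + replicate_mset j b'"
      have mj: "m - j = Suc (m - Suc j)" using Suc.prems by simp
      have LJ: "set_mset ?L \<subseteq> J" using RJ b b' by auto
      have IH: "c \<le> (\<Sum>d\<in>#?L. \<alpha> d) + b'"
        using Suc.IH Suc.prems by (simp add: mj eq algebra_simps)
      \<comment> \<open>An empty remainder would make \<open>M\<close> a single \<open>b\<close>,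
        whose sum is at most \<open>c\<close>. Nonemptiness makes the next comparison
        strict.\<close>
      have ne: "?L \<noteq> {#}"
      proof
        assume "?L = {#}"
        then have "R = {#}" "m = 1" using Suc.prems by auto
        then have "(\<Sum>d\<in>#M. d) = b" by (simp add: split)
        then show False using le[OF b] M(2) by simp
      qed
      have "(\<Sum>d\<in>#?L. \<alpha> d) < (\<Sum>d\<in>#?L. d)"
        by (rule sum_mset_strict_mono_on) (use lt LJ ne in auto)
      with IH have "c < (\<Sum>d\<in>#?L + {#b'#}. d)" by simp
      then have "c \<le> (\<Sum>d\<in>#?L + {#b'#}. \<alpha> d)"
        using LJ b' by (intro avoid) auto
      then show ?case by (simp add: algebra_simps)
    qed
    have "(\<Sum>d\<in>#R. ?\<alpha> d) = (\<Sum>d\<in>#R. \<alpha> d)"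
      using Rb by (intro arg_cong[where f = sum_mset] image_mset_cong) auto
    then show ?thesis using step[of m] by (simp add: split)
  qed
  have "?\<alpha> d \<le> d" if "d \<in> J" for d
    using lt[OF that] lt[OF b'] bb by auto
  moreover have "d' \<le> ?\<alpha> d" if "d \<in> J - {b'}" "d' \<in> J - {b'}" "d' < d" for d d'
  proof (cases "d = b")
    case True
    then have "d' < b'" using sep[of d d'] that eq by auto
    then show ?thesis using sep[of b' d'] that b' True by auto
  qed (use sep that in auto)
  moreover have "0 < ?\<alpha> d" if "d \<in> J" for d using pos that b' by simp
  ultimately show ?thesis
    using merged unfolding gap_system_def by blast
qed


section \<open>Existence of an optimal system\<close>

lemma gap_system_cong:
  assumes "\<And>b. b \<in> J \<Longrightarrow> \<alpha> b = \<beta> b"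
  shows "gap_system c J \<alpha> \<longleftrightarrow> gap_system c J \<beta>"
proof -
  have "(\<Sum>b\<in>#M. \<alpha> b) = (\<Sum>b\<in>#M. \<beta> b)" if "set_mset M \<subseteq> J" for M
    using assms that by (intro arg_cong[where f = sum_mset] image_mset_cong) auto
  then show ?thesis using assms by (simp add: gap_system_def)
qed

lemma continuous_on_sum_mset_apply:
  "continuous_on UNIV (\<lambda>\<alpha>::real \<Rightarrow> real. \<Sum>b\<in>#M. \<alpha> b)"
  by (induction M) (auto intro!: continuous_intros)

text \<open>Take \<open>n\<close> copies of \<open>b\<close>. This keeps left endpoints away from 0
  uniformly over all systems, where \<open>ln\<close> is continuous.\<close>

lemma gap_system_lower_bound:
  assumes "gap_system c J \<alpha>" "b \<in> J" "c < real n * b"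
  shows "c \<le> real n * \<alpha> b"
proof -
  have "set_mset (replicate_mset n b) \<subseteq> J" using assms(2) by auto
  moreover have "c < (\<Sum>d\<in>#replicate_mset n b. d)" using assms(3) by simp
  ultimately have "c \<le> (\<Sum>d\<in>#replicate_mset n b. \<alpha> d)"
    using assms(1) unfolding gap_system_def by blast
  then show ?thesis by simp
qed

text \<open>Existence is by compactness: the lower bound confines the left endpoints to a box, and
  the remaining conditions are closed.\<close>

lemma gap_system_minimiser:
  assumes fin: "finite J" and c: "0 < c" and pos: "\<And>b. b \<in> J \<Longrightarrow> 0 < b"
    and sys: "gap_system c J \<alpha>"
  obtains \<beta> where "gap_system c J \<beta>"
    "\<And>\<gamma>. gap_system c J \<gamma> \<Longrightarrow> (\<Sum>b\<in>J. ln (\<beta> b)) \<le> (\<Sum>b\<in>J. ln (\<gamma> b))"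
proof -
  define e where "e = Min (insert 1 J)"
  have "0 < e" "\<And>b. b \<in> J \<Longrightarrow> e \<le> b" using fin pos by (auto simp: e_def)
  obtain n where n: "c < real n * e" using reals_Archimedean3[OF \<open>0 < e\<close>] by blast
  have "0 < real n" using n c \<open>0 < e\<close> by (metis less_trans zero_less_mult_pos2)
  have low: "c / real n \<le> \<gamma> b" if "gap_system c J \<gamma>" "b \<in> J" for \<gamma> b
  proof -
    have "real n * e \<le> real n * b" using \<open>\<And>b. b \<in> J \<Longrightarrow> e \<le> b\<close> that by (intro mult_left_mono) auto
    then have "c \<le> real n * \<gamma> b" using gap_system_lower_bound[OF that] n by simp
    then show ?thesis using \<open>0 < real n\<close> by (simp add: field_simps)
  qed
  have lowpos: "0 < c / real n" using c \<open>0 < real n\<close> by simp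
  \<comment> \<open>Coordinates outside \<open>J\<close> are frozen at 0, so that the box is compact
    in the product topology on all functions; \<open>res\<close> brings any system into this
    form.\<close>
  define P where "P = PiE (UNIV :: real set) (\<lambda>b. if b \<in> J then {c / real n..b} else {0::real})"
  define Q where "Q = {\<gamma>. (\<forall>b\<in>J. \<forall>b'\<in>J. b' < b \<longrightarrow> b' \<le> \<gamma> b) \<and>
     (\<forall>M. set_mset M \<subseteq> J \<longrightarrow> c < (\<Sum>b\<in>#M. b) \<longrightarrow> c \<le> (\<Sum>b\<in>#M. \<gamma> b))}"
  have "compactin (product_topology (\<lambda>_. euclidean) (UNIV :: real set)) P"
    unfolding P_def by (auto simp: compactin_PiE compactin_euclidean_iff)
  then have "compact P" by (simp add: euclidean_product_topology compactin_euclidean_iff)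
  moreover have "closed Q"
    unfolding Q_def Ball_def
    by (intro closed_Collect_conj closed_Collect_all closed_Collect_imp closed_Collect_le open_Collect_const
        continuous_on_const continuous_on_sum_mset_apply continuous_on_product_coordinates)
  ultimately have comp: "compact (P \<inter> Q)" by (rule compact_Int_closed)
  have sysI: "gap_system c J \<gamma>" if "\<gamma> \<in> P \<inter> Q" for \<gamma>
  proof -
    have "c / real n \<le> \<gamma> b \<and> \<gamma> b \<le> b" if "b \<in> J" for b
    proof -
      have "\<gamma> b \<in> (if b \<in> J then {c / real n..b} else {0})"
        using \<open>\<gamma> \<in> P \<inter> Q\<close> unfolding P_def by blast
      then show ?thesis using that by simp
    qed
    then show ?thesis using \<open>\<gamma> \<in> P \<inter> Q\<close> lowpos unfolding gap_system_def Q_def by force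
  qed
  define res where "res \<gamma> = (\<lambda>b. if b \<in> J then \<gamma> b else (0::real))" for \<gamma> :: "real \<Rightarrow> real"
  have res: "res \<gamma> \<in> P \<inter> Q" if "gap_system c J \<gamma>" for \<gamma>
  proof -
    have "gap_system c J (res \<gamma>)"
      using that by (subst gap_system_cong[of _ _ \<gamma>]) (auto simp: res_def)
    then have "res \<gamma> \<in> Q" by (auto simp: Q_def gap_system_def)
    moreover have "res \<gamma> \<in> P"
      using that low[OF that] by (auto simp: P_def res_def gap_system_def)
    ultimately show ?thesis by simp
  qed
  have ne: "\<gamma> b \<noteq> 0" if "\<gamma> \<in> P \<inter> Q" "b \<in> J" for \<gamma> b
    using sysI[OF that(1)] that(2) by (auto simp: gap_system_def)
  have "continuous_on (P \<inter> Q) (\<lambda>\<gamma>. \<Sum>b\<in>J. ln (\<gamma> b))"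
    by (intro continuous_on_sum continuous_on_ln)
      (use ne in \<open>auto intro: continuous_on_subset[OF continuous_on_product_coordinates]\<close>)
  then obtain \<beta> where \<beta>: "\<beta> \<in> P \<inter> Q" "\<And>\<gamma>. \<gamma> \<in> P \<inter> Q \<Longrightarrow> (\<Sum>b\<in>J. ln (\<beta> b)) \<le> (\<Sum>b\<in>J. ln (\<gamma> b))"
    using continuous_attains_inf[OF comp] res[OF sys] by blast
  show ?thesis
  proof (rule that[OF sysI[OF \<beta>(1)]])
    fix \<gamma> assume "gap_system c J \<gamma>"
    then show "(\<Sum>b\<in>J. ln (\<beta> b)) \<le> (\<Sum>b\<in>J. ln (\<gamma> b))"
      using \<beta>(2)[OF res] by (simp add: res_def)
  qed
qed

section \<open>Tight multisets and perturbation\<close>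

lemma gap_system_tight_le:
  assumes fin: "finite J" and sys: "gap_system c J \<alpha>"
    and lt: "\<And>d. d \<in> J \<Longrightarrow> \<alpha> d < d"
    and M: "set_mset M \<subseteq> J" and tight: "(\<Sum>d\<in>#M. \<alpha> d) = c" and b: "b \<in># M"
  shows "(\<Sum>d\<in>#M. d) - c \<le> b - pred_in J b"
proof -
  define p where "p = pred_in J b"
  \<comment> \<open>If nothing in \<open>J\<close> lies below \<open>b\<close>, then
    \<open>p = 0\<close> and \<open>b\<close> is just removed. Either way the right endpoints change
    by \<open>p - b\<close> in total.\<close>
  define M' where "M' = M - {#b#} + (if p = 0 then {#} else {#p#})"
  have pos: "0 < \<alpha> d" if "d \<in> J" for d using sys that by (auto simp: gap_system_def)
  have bJ: "b \<in> J" using M b by auto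
  have "p \<in> insert 0 {b'\<in>J. b' < b}"
    unfolding p_def pred_in_def by (rule Max_in) (use fin in auto)
  then have p: "p = 0 \<or> p \<in> J \<and> p < b" by auto
  have split: "M = (M - {#b#}) + {#b#}" using b by simp
  \<comment> \<open>The exchange strictly lowers the left sum because
    \<open>\<alpha> p < p \<le> \<alpha> b\<close>.\<close>
  have "\<alpha> p < \<alpha> b" if "p \<noteq> 0"
  proof -
    have "p \<le> \<alpha> b" using sys p that bJ by (auto simp: gap_system_def)
    then show ?thesis using lt[of p] p that by auto
  qed
  moreover have "(\<Sum>d\<in>#M. \<alpha> d) = (\<Sum>d\<in>#M - {#b#}. \<alpha> d) + \<alpha> b"
    by (subst split) simp
  ultimately have "(\<Sum>d\<in>#M'. \<alpha> d) < c"
    using tight pos[OF bJ] by (simp add: M'_def)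
  moreover have "set_mset M' \<subseteq> J" using M p by (auto simp: M'_def dest: in_diffD)
  ultimately have "(\<Sum>d\<in>#M'. d) \<le> c"
    using sys unfolding gap_system_def by (meson not_le)
  moreover have "(\<Sum>d\<in>#M. d) = (\<Sum>d\<in>#M - {#b#}. d) + b"
    by (subst split) simp
  moreover have "(\<Sum>d\<in>#M'. d) = (\<Sum>d\<in>#M - {#b#}. d) + p" by (simp add: M'_def)
  ultimately show ?thesis by (simp add: p_def)
qed

text \<open>Strict inequalities survive a small move along \<open>- v\<close>, tight multisets
  tolerate it by the sign of \<open>v\<close>, and \<open>big\<close> makes the derivative of the
  sum of logarithms negative.\<close>

lemma gap_system_perturb:
  assumes fin: "finite J" and c: "0 < c" and D: "0 \<le> D" "\<And>b. b \<in> J \<Longrightarrow> b \<le> D"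
    and sys: "gap_system c J \<alpha>"
    and lt: "\<And>d. d \<in> J \<Longrightarrow> \<alpha> d < d"
    and sep: "\<And>b b'. b \<in> J \<Longrightarrow> b' \<in> J \<Longrightarrow> b' < b \<Longrightarrow> b' < \<alpha> b"
    and big: "D / c < (\<Sum>b\<in>J. (b - \<alpha> b) / \<alpha> b)"
  obtains \<beta> where "gap_system c J \<beta>" "(\<Sum>b\<in>J. ln (\<beta> b)) < (\<Sum>b\<in>J. ln (\<alpha> b))"
proof -
  have pos: "0 < \<alpha> d" if "d \<in> J" for d using sys that by (auto simp: gap_system_def)
  have avoid: "c \<le> (\<Sum>d\<in>#M. \<alpha> d)" if "set_mset M \<subseteq> J" "c < (\<Sum>d\<in>#M. d)" for M
    using sys that by (auto simp: gap_system_def)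
  define v where "v b = (b - \<alpha> b) - \<alpha> b * (b - pred_in J b) / c" for b
  define \<beta> where "\<beta> t b = \<alpha> b - t * v b" for t b
  have lim: "((\<lambda>t. \<beta> t b) \<longlongrightarrow> \<alpha> b) (at_right 0)" for b
    unfolding \<beta>_def by (auto intro!: tendsto_eq_intros)
  have limM: "((\<lambda>t. \<Sum>b\<in>#M. \<beta> t b) \<longlongrightarrow> (\<Sum>b\<in>#M. \<alpha> b)) (at_right 0)" for M
    by (induction M) (auto intro!: tendsto_intros lim)
  \<comment> \<open>Halving leaves room: left endpoints stay above \<open>e\<close> after a small
    move. Multisets with more than \<open>n\<close> elements then exceed \<open>c\<close>
    automatically, so only the finitely many in \<open>\<M>\<close> need checking.\<close>
  define e where "e = Min (insert 1 (\<alpha> ` J)) / 2"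
  have e: "0 < e" "\<And>b. b \<in> J \<Longrightarrow> e < \<alpha> b"
  proof -
    have "0 < Min (insert 1 (\<alpha> ` J))" using fin pos by simp
    moreover have "Min (insert 1 (\<alpha> ` J)) \<le> \<alpha> b" if "b \<in> J" for b using fin that by simp
    ultimately show "0 < e" "\<And>b. b \<in> J \<Longrightarrow> e < \<alpha> b" by (force simp: e_def)+
  qed
  obtain n where n: "c < real n * e" using reals_Archimedean3[OF e(1)] by blast
  define \<M> where "\<M> = {M. set_mset M \<subseteq> J \<and> size M \<le> n \<and> c < (\<Sum>b\<in>#M. b)}"
  have "\<M> \<subseteq> (\<Union>k\<le>n. multisets_of_size J k)" by (auto simp: \<M>_def multisets_of_size_def)
  then have fM: "finite \<M>" by (rule finite_subset) (use fin in auto)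
  have ev1: "\<forall>\<^sub>F t in at_right 0. \<forall>b\<in>J. e < \<beta> t b"
    using fin by (intro eventually_ball_finite ballI order_tendstoD(1)[OF lim] e(2))
  have ev2: "\<forall>\<^sub>F t in at_right 0. \<forall>b\<in>J. \<beta> t b < b"
    using fin by (intro eventually_ball_finite ballI order_tendstoD(2)[OF lim] lt)
  have "\<forall>\<^sub>F t in at_right 0. b' < b \<longrightarrow> b' < \<beta> t b" if "b \<in> J" "b' \<in> J" for b b'
    by (cases "b' < b") (use that in \<open>auto intro: order_tendstoD(1)[OF lim] sep\<close>)
  then have ev3: "\<forall>\<^sub>F t in at_right 0. \<forall>b\<in>J. \<forall>b'\<in>J. b' < b \<longrightarrow> b' < \<beta> t b"
    using fin by (intro eventually_ball_finite ballI) auto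
  have tight: "(\<Sum>b\<in>#M. v b) \<le> 0" if M: "set_mset M \<subseteq> J" and tt: "(\<Sum>b\<in>#M. \<alpha> b) = c" for M
  proof -
    let ?s = "(\<Sum>d\<in>#M. d) - c"
    have "?s * c = (\<Sum>b\<in>#M. \<alpha> b * ?s)"
      by (simp add: tt[symmetric] sum_mset_distrib_right mult.commute)
    also have "\<dots> \<le> (\<Sum>b\<in>#M. \<alpha> b * (b - pred_in J b))"
    proof (rule sum_mset_mono)
      fix b assume "b \<in># M"
      then show "\<alpha> b * ?s \<le> \<alpha> b * (b - pred_in J b)"
        using gap_system_tight_le[OF fin sys lt M tt] pos M by (intro mult_left_mono) (auto intro: less_imp_le)
    qed
    finally have "?s \<le> (\<Sum>b\<in>#M. \<alpha> b * (b - pred_in J b)) / c" using c by (simp add: field_simps)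
    moreover have "(\<Sum>b\<in>#M. v b) = (\<Sum>b\<in>#M. b) - (\<Sum>b\<in>#M. \<alpha> b) - (\<Sum>b\<in>#M. \<alpha> b * (b - pred_in J b)) / c"
      by (induction M) (simp_all add: v_def diff_divide_distrib add_divide_distrib)
    ultimately show ?thesis using tt by simp
  qed
  \<comment> \<open>A tight sum cannot decrease, as it changes by \<open>- t\<close> times a
    nonpositive sum of \<open>v\<close>. Any other sum starts strictly above \<open>c\<close> and
    stays there by continuity.\<close>
  have "\<forall>\<^sub>F t in at_right 0. c \<le> (\<Sum>b\<in>#M. \<beta> t b)" if "M \<in> \<M>" for M
  proof (cases "(\<Sum>b\<in>#M. \<alpha> b) = c")
    case True
    have "(\<Sum>b\<in>#M. \<beta> t b) = (\<Sum>b\<in>#M. \<alpha> b) - t * (\<Sum>b\<in>#M. v b)" for t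
      by (induction M) (simp_all add: \<beta>_def algebra_simps)
    moreover have "t * (\<Sum>b\<in>#M. v b) \<le> 0" if "0 < t" for t
      using tight[OF _ True] that \<open>M \<in> \<M>\<close> by (auto simp: \<M>_def intro: mult_nonneg_nonpos)
    ultimately show ?thesis using True by (auto simp: eventually_at_right_less intro!: eventually_at_rightI[of 0 1])
  next
    case False
    then have "c < (\<Sum>b\<in>#M. \<alpha> b)" using avoid[of M] that by (auto simp: \<M>_def)
    then show ?thesis using order_tendstoD(1)[OF limM] by (fastforce elim: eventually_mono)
  qed
  then have ev4: "\<forall>\<^sub>F t in at_right 0. \<forall>M\<in>\<M>. c \<le> (\<Sum>b\<in>#M. \<beta> t b)"
    using fM by (intro eventually_ball_finite ballI) auto
  have "(\<Sum>b\<in>J. v b / \<alpha> b) = (\<Sum>b\<in>J. (b - \<alpha> b) / \<alpha> b) - (\<Sum>b\<in>J. b - pred_in J b) / c"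
  proof -
    have "v b / \<alpha> b = (b - \<alpha> b) / \<alpha> b - (b - pred_in J b) / c" if "b \<in> J" for b
      using pos[OF that] c by (simp add: v_def field_simps)
    then show ?thesis by (simp add: sum_subtractf sum_divide_distrib diff_divide_distrib)
  qed
  moreover have "(\<Sum>b\<in>J. b - pred_in J b) / c \<le> D / c"
    using c lt pos D by (intro divide_right_mono sum_gaps_le fin) (auto intro: less_trans)
  ultimately have vpos: "0 < (\<Sum>b\<in>J. v b / \<alpha> b)" using big by simp
  have "((\<lambda>t. \<Sum>b\<in>J. ln (\<beta> t b)) has_real_derivative (\<Sum>b\<in>J. - v b / \<alpha> b)) (at 0)"
    unfolding \<beta>_def using pos by (auto intro!: derivative_eq_intros)
  moreover have "(\<Sum>b\<in>J. - v b / \<alpha> b) < 0" using vpos by (simp add: sum_negf)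
  ultimately obtain d where "0 < d"
    and d: "\<And>h. 0 < h \<Longrightarrow> h < d \<Longrightarrow> (\<Sum>b\<in>J. ln (\<beta> (0 + h) b)) < (\<Sum>b\<in>J. ln (\<beta> 0 b))"
    using DERIV_neg_dec_right by blast
  then have ev5: "\<forall>\<^sub>F t in at_right 0. (\<Sum>b\<in>J. ln (\<beta> t b)) < (\<Sum>b\<in>J. ln (\<alpha> b))"
    by (auto simp: \<beta>_def intro!: eventually_at_rightI[of 0 d])
  from ev1 ev2 ev3 ev4 ev5
  have "\<forall>\<^sub>F t in at_right 0. gap_system c J (\<beta> t) \<and> (\<Sum>b\<in>J. ln (\<beta> t b)) < (\<Sum>b\<in>J. ln (\<alpha> b))"
  proof eventually_elim
    case (elim t)
    have "c \<le> (\<Sum>b\<in>#M. \<beta> t b)" if "set_mset M \<subseteq> J" "c < (\<Sum>b\<in>#M. b)" for M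
    proof (cases "size M \<le> n")
      case True
      then show ?thesis using elim that by (auto simp: \<M>_def)
    next
      case False
      then have "real n * e \<le> real (size M) * e" using e(1) by simp
      also have "\<dots> = (\<Sum>b\<in>#M. e)" by simp
      also have "\<dots> \<le> (\<Sum>b\<in>#M. \<beta> t b)"
        using elim that by (intro sum_mset_mono) (auto intro: less_imp_le)
      finally show ?thesis using n by simp
    qed
    then show ?case using elim e(1) unfolding gap_system_def by (meson less_imp_le less_trans)
  qed
  then obtain t where "gap_system c J (\<beta> t)" "(\<Sum>b\<in>J. ln (\<beta> t b)) < (\<Sum>b\<in>J. ln (\<alpha> b))"
    using eventually_happens trivial_limit_at_right_real by (metis (mono_tags, lifting))
  then show ?thesis by (rule that)
qed


section \<open>The logarithmic bound\<close>

text \<open>Induction on the number of intervals, at the optimum \<open>\<beta>\<close>: an empty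
  interval contributes \<open>ln 1 = 0\<close> and is dropped, touching ones are merged, and
  otherwise the perturbation would contradict optimality.\<close>

lemma sum_ln_ratio_le:
  assumes "finite J" "0 < c" "0 \<le> D" "\<And>b. b \<in> J \<Longrightarrow> b \<le> D" "\<And>b. b \<in> J \<Longrightarrow> b \<le> c"
    and "gap_system c J \<alpha>"
  shows "(\<Sum>b\<in>J. ln (b / \<alpha> b)) \<le> D / c"
  using assms
proof (induction "card J" arbitrary: J \<alpha> rule: less_induct)
  case less
  note fin = less.prems(1) and c = less.prems(2) and D = less.prems(3,4) and le = less.prems(5)
    and sys = less.prems(6)
  have pos: "0 < b" if "b \<in> J" for b
    using sys that unfolding gap_system_def by (meson less_le_trans)
  obtain \<beta> where \<beta>: "gap_system c J \<beta>"
    and min: "\<And>\<gamma>. gap_system c J \<gamma> \<Longrightarrow> (\<Sum>b\<in>J. ln (\<beta> b)) \<le> (\<Sum>b\<in>J. ln (\<gamma> b))"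
    using gap_system_minimiser[OF fin c pos sys] by blast
  have split: "(\<Sum>b\<in>J. ln (b / \<gamma> b)) = (\<Sum>b\<in>J. ln b) - (\<Sum>b\<in>J. ln (\<gamma> b))"
    if "gap_system c J \<gamma>" for \<gamma>
  proof -
    have "ln (b / \<gamma> b) = ln b - ln (\<gamma> b)" if "b \<in> J" for b
    proof -
      have "0 < \<gamma> b" using \<open>gap_system c J \<gamma>\<close> that by (auto simp: gap_system_def)
      then show ?thesis using pos[OF that] by (simp add: ln_div)
    qed
    then show ?thesis by (simp add: sum_subtractf)
  qed
  have \<beta>pos: "0 < \<beta> b" "\<beta> b \<le> b" if "b \<in> J" for b using \<beta> that by (auto simp: gap_system_def)
  have "(\<Sum>b\<in>J. ln (b / \<beta> b)) \<le> D / c"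
  proof (cases "\<exists>b\<in>J. \<beta> b = b")
    case True
    then obtain b where b: "b \<in> J" "\<beta> b = b" by auto
    have "(\<Sum>d\<in>J. ln (d / \<beta> d)) = (\<Sum>d\<in>J - {b}. ln (d / \<beta> d))"
      using b fin pos[OF b(1)] by (simp add: sum.remove[OF fin b(1)])
    also have "\<dots> \<le> D / c"
    proof (rule less.hyps)
      show "card (J - {b}) < card J" using b fin by (meson card_Diff1_less)
      show "gap_system c (J - {b}) \<beta>" using gap_system_subset[OF \<beta>] by blast
    qed (use fin c D le in auto)
    finally show ?thesis .
  next
    case False
    then have lt: "\<beta> b < b" if "b \<in> J" for b using \<beta>pos[OF that] that by force
    show ?thesis
    proof (cases "\<exists>b\<in>J. \<beta> b \<in> J")
      case True
      then obtain b b' where b: "b \<in> J" and b': "b' \<in> J" and eq: "\<beta> b = b'" by auto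
      have bb: "b' < b" using lt[OF b] eq by simp
      let ?\<beta> = "\<beta>(b := \<beta> b')"
      have b1: "b \<in> J - {b'}" and fin1: "finite (J - {b'})" using b bb fin by auto
      \<comment> \<open>Merging keeps the total:
        \<open>ln (b' / \<beta> b') + ln (b / b') = ln (b / \<beta> b')\<close>.\<close>
      have "(\<Sum>d\<in>J. ln (d / \<beta> d)) = ln (b' / \<beta> b') + (ln (b / b') + (\<Sum>d\<in>J - {b'} - {b}. ln (d / \<beta> d)))"
        by (simp add: sum.remove[OF fin b'] sum.remove[OF fin1 b1] eq)
      also have "\<dots> = ln (b / \<beta> b') + (\<Sum>d\<in>J - {b'} - {b}. ln (d / ?\<beta> d))"
        using pos[OF b] pos[OF b'] \<beta>pos[OF b'] by (simp add: ln_div)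
      also have "\<dots> = (\<Sum>d\<in>J - {b'}. ln (d / ?\<beta> d))"
        by (simp add: sum.remove[OF fin1 b1])
      also have "\<dots> \<le> D / c"
      proof (rule less.hyps)
        show "card (J - {b'}) < card J" using b' fin by (meson card_Diff1_less)
        show "gap_system c (J - {b'}) ?\<beta>" by (rule gap_system_merge[OF \<beta> lt le b b' eq])
      qed (use fin c D le in auto)
      finally show ?thesis .
    next
      case False
      have sep: "b' < \<beta> b" if "b \<in> J" "b' \<in> J" "b' < b" for b b'
      proof -
        have "b' \<le> \<beta> b" using \<beta> that by (auto simp: gap_system_def)
        moreover have "b' \<noteq> \<beta> b" using False that by auto
        ultimately show ?thesis by simp
      qed
      have "(\<Sum>b\<in>J. (b - \<beta> b) / \<beta> b) \<le> D / c"
      proof (rule ccontr)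
        assume "\<not> ?thesis"
        then have big: "D / c < (\<Sum>b\<in>J. (b - \<beta> b) / \<beta> b)" by simp
        obtain \<gamma> where "gap_system c J \<gamma>" "(\<Sum>b\<in>J. ln (\<gamma> b)) < (\<Sum>b\<in>J. ln (\<beta> b))"
          using gap_system_perturb[OF fin c D \<beta> lt sep big] by blast
        then show False using min[of \<gamma>] by simp
      qed
      moreover have "(\<Sum>b\<in>J. ln (b / \<beta> b)) \<le> (\<Sum>b\<in>J. (b - \<beta> b) / \<beta> b)"
      proof (rule sum_mono)
        fix b assume "b \<in> J"
        then show "ln (b / \<beta> b) \<le> (b - \<beta> b) / \<beta> b"
          using ln_le_minus_one[of "b / \<beta> b"] pos \<beta>pos by (simp add: diff_divide_distrib)
      qed
      ultimately show ?thesis by simp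
    qed
  qed
  then show ?case using min[OF sys] by (simp add: split[OF \<beta>] split[OF sys])
qed

section \<open>Elementary estimates\<close>

text \<open>The difference of the two sides vanishes at 0 and has derivative
  \<open>t^2 / (1 + t)\<close>.\<close>

lemma ln_add_one_ge_quadratic:
  fixes x :: real
  assumes "0 \<le> x"
  shows "x - x\<^sup>2 / 2 \<le> ln (1 + x)"
proof -
  let ?f = "\<lambda>x::real. ln (1 + x) - (x - x\<^sup>2 / 2)"
  have "?f 0 \<le> ?f x"
  proof (rule DERIV_nonneg_imp_nondecreasing[OF assms])
    fix t :: real assume t: "0 \<le> t" "t \<le> x"
    have "(?f has_real_derivative 1 / (1 + t) - (1 - t)) (at t)"
      using t by (auto intro!: derivative_eq_intros simp: field_simps)
    moreover have "1 / (1 + t) - (1 - t) = t\<^sup>2 / (1 + t)"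
      using t by (simp add: field_simps power2_eq_square)
    ultimately show "\<exists>y. (?f has_real_derivative y) (at t) \<and> 0 \<le> y" using t by force
  qed
  then show ?thesis by simp
qed

text \<open>Each term is at most \<open>1 / (a - 1/2) - 1 / (a + 1/2) = 1 / (a^2 - 1/4)\<close>, and
  these differences telescope.\<close>

lemma sum_inverse_squares_le:
  fixes r :: real
  assumes "finite A" "0 < r" and gt: "\<And>a. a \<in> A \<Longrightarrow> r < real a - 1 / 2"
  shows "(\<Sum>a\<in>A. 1 / (real a)\<^sup>2) \<le> 1 / r"
proof (cases "A = {}")
  case False
  define m where "m = Min A"
  have "m \<in> A" and m: "\<And>a. a \<in> A \<Longrightarrow> m \<le> a" using assms(1) False by (auto simp: m_def)
  then have rm: "r < real m - 1 / 2" using gt by simp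
  let ?g = "\<lambda>a. 1 / (real a - 1 / 2)"
  have "(\<Sum>a\<in>A. 1 / (real a)\<^sup>2) \<le> (\<Sum>a\<in>{m..<Suc (Max A)}. 1 / (real a)\<^sup>2)"
    using assms(1) m by (intro sum_mono2) (auto simp: less_Suc_eq_le)
  also have "\<dots> \<le> (\<Sum>a\<in>{m..<Suc (Max A)}. ?g a - ?g (Suc a))"
  proof (rule sum_mono)
    fix a assume "a \<in> {m..<Suc (Max A)}"
    then have a: "0 < real a - 1 / 2" using rm assms(2) by simp
    then have "?g a - ?g (Suc a) = 1 / ((real a)\<^sup>2 - 1 / 4)"
      by (simp add: field_simps power2_eq_square)
    moreover have "0 < (real a)\<^sup>2 - 1 / 4"
    proof -
      have "(real a)\<^sup>2 - 1 / 4 = (real a - 1 / 2) * (real a + 1 / 2)"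
        by (simp add: field_simps power2_eq_square)
      then show ?thesis using a by simp
    qed
    ultimately show "1 / (real a)\<^sup>2 \<le> ?g a - ?g (Suc a)"
      by (simp add: frac_le)
  qed
  also have "\<dots> = ?g m - ?g (Suc (Max A))"
    using sum_Suc_diff'[of m "Suc (Max A)" "\<lambda>a. - ?g a"] m assms(1) False \<open>m \<in> A\<close>
    by (simp add: le_SucI)
  also have "\<dots> \<le> ?g m" by simp
  also have "\<dots> \<le> 1 / r" using rm assms(2) by (intro frac_le) auto
  finally show ?thesis .
qed (use assms in simp)

section \<open>Application to the intervals from \<open>a\<close> to \<open>a + 1\<close>\<close>

theorem proposition1p2:
  fixes N u :: real and A :: "nat set"
  assumes "N \<ge> u" and "u \<ge> 1" and "N > 1"
    and "A \<subseteq> {1..nat \<lfloor>N / u\<rfloor>}"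
    and "(\<Sum>a\<in>A. 1 / real a) > 1 / u + 1 / (sqrt N - 1)"
  shows "\<exists>(k::nat) (a :: nat \<Rightarrow> nat). k \<ge> 1 \<and> (\<forall>i\<in>{1..k}. a i \<in> A) \<and>
           N - real k < real (\<Sum>i=1..k. a i) \<and> real (\<Sum>i=1..k. a i) \<le> N"
proof (rule ccontr)
  assume contra: "\<not> ?thesis"
  have fin: "finite A" using assms(4) finite_subset by blast
  have ge1: "1 \<le> a" and le: "real a \<le> N / u" if "a \<in> A" for a
  proof -
    have "a \<in> {1..nat \<lfloor>N / u\<rfloor>}" using assms(4) that by auto
    then show "1 \<le> a" "real a \<le> N / u" using assms by (auto simp: le_nat_floor nat_le_iff le_nat_iff le_floor_iff)
  qed
  \<comment> \<open>The two sums differ by the size of \<open>M\<close>, which plays the role of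
    \<open>k\<close>; \<open>f\<close> enumerates \<open>M\<close> from index 1.\<close>
  have avoid: "(\<Sum>a\<in>#M. real a + 1) \<le> N \<or> N < (\<Sum>a\<in>#M. real a)" if M: "set_mset M \<subseteq> A" for M
  proof (cases "M = {#}")
    case False
    obtain xs where xs: "mset xs = M" using ex_mset by blast
    define f where "f i = xs ! (i - 1)" for i :: nat
    have "(\<Sum>i=1..length xs. f i) = sum_list xs"
      unfolding f_def sum_list_sum_nth
      by (rule sum.reindex_bij_witness[of _ Suc "\<lambda>i. i - 1"]) auto
    moreover have "\<forall>i\<in>{1..length xs}. f i \<in> A"
    proof
      fix i assume "i \<in> {1..length xs}"
      then have "f i \<in> set xs" unfolding f_def by (intro nth_mem) auto
      then show "f i \<in> A" using M xs by auto
    qed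
    moreover have "1 \<le> length xs" using False xs by (cases xs) auto
    ultimately have "\<not> (N - real (length xs) < real (sum_list xs) \<and> real (sum_list xs) \<le> N)"
      using contra by metis
    moreover have "real (sum_list xs) = (\<Sum>a\<in>#M. real a)"
      unfolding xs[symmetric] by (induction xs) auto
    moreover have "(\<Sum>a\<in>#M. real a + 1) = (\<Sum>a\<in>#M. real a) + real (length xs)"
      unfolding xs[symmetric] by (induction xs) auto
    ultimately show ?thesis by auto
  qed (use assms in simp)
  \<comment> \<open>For a singleton the second alternative fails, since
    \<open>a \<le> N / u \<le> N\<close>.\<close>
  have leN: "real a + 1 \<le> N" if "a \<in> A" for a
  proof -
    have "N / u \<le> N" using assms by (simp add: divide_le_eq mult_le_cancel_left1)
    then show ?thesis using avoid[of "{#a#}"] that le[OF that] by auto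
  qed
  define J where "J = (\<lambda>a. real a + 1) ` A"
  have sys: "gap_system N J (\<lambda>b. b - 1)"
    unfolding gap_system_def
  proof (intro conjI ballI allI impI)
    fix b assume "b \<in> J"
    then show "0 < b - 1" "b - 1 \<le> b" using ge1 by (force simp: J_def)+
  next
    fix b b' assume "b \<in> J" "b' \<in> J" "b' < b"
    then show "b' \<le> b - 1" by (auto simp: J_def)
  next
    fix M assume M: "set_mset M \<subseteq> J" "N < (\<Sum>b\<in>#M. b)"
    define M' where "M' = image_mset (inv_into A (\<lambda>a. real a + 1)) M"
    have "image_mset (\<lambda>a. real a + 1) M' = image_mset (\<lambda>b. b) M"
      unfolding M'_def image_mset.compositionality comp_def
      using M(1) by (intro image_mset_cong f_inv_into_f) (auto simp: J_def)
    then have M': "M = image_mset (\<lambda>a. real a + 1) M'" by simp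
    have M'A: "set_mset M' \<subseteq> A"
      using M(1) by (auto simp: M'_def J_def intro!: inv_into_into)
    then show "N \<le> (\<Sum>b\<in>#M. b - 1)"
      using avoid[OF M'A] M(2) by (auto simp: M' image_mset.compositionality comp_def)
  qed
  \<comment> \<open>Here \<open>c = N\<close> and \<open>D = N / u + 1\<close>, the latter because
    right endpoints are \<open>a + 1\<close> with \<open>a \<le> N / u\<close>.\<close>
  have "(\<Sum>b\<in>J. ln (b / (b - 1))) \<le> (N / u + 1) / N"
    by (rule sum_ln_ratio_le[OF _ _ _ _ _ sys]) (use assms fin le leN in \<open>auto simp: J_def\<close>)
  also have "(\<Sum>b\<in>J. ln (b / (b - 1))) = (\<Sum>a\<in>A. ln (1 + 1 / real a))"
  proof -
    have "(real a + 1) / real a = 1 + 1 / real a" if "a \<in> A" for a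
      using ge1[OF that] by (simp add: field_simps)
    then show ?thesis by (simp add: J_def sum.reindex inj_on_def)
  qed
  finally have ln_le: "(\<Sum>a\<in>A. ln (1 + 1 / real a)) \<le> 1 / u + 1 / N"
    using assms by (simp add: add_divide_distrib)
  have rt: "0 < sqrt N - 1" using assms by simp
  \<comment> \<open>Take as many copies of \<open>a\<close> as fit below \<open>N\<close>: then
    \<open>k * (a + 1) \<le> N < (k + 1) * a\<close>, which forces
    \<open>N < a * (a + 1) < (a + 1/2)^2\<close>.\<close>
  have big: "sqrt N - 1 < real a - 1 / 2" if "a \<in> A" for a
  proof -
    define k where "k = nat \<lfloor>N / real a\<rfloor>"
    have a: "0 < real a" using ge1[OF that] by simp
    have k: "real k \<le> N / real a" "N / real a < real k + 1"
      using assms(3) a by (auto simp: k_def)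
    have "real k * real a \<le> N" using k(1) a by (simp add: field_simps)
    then have "real k * (real a + 1) \<le> N"
      using avoid[of "replicate_mset k a"] that by (auto split: if_splits)
    then have "real k * real a * (real a + 1) \<le> N * real a"
      using a by (metis mult.assoc mult.commute mult_right_mono less_imp_le)
    moreover have "N * (real a + 1) < (real k + 1) * real a * (real a + 1)"
      using k(2) a by (simp add: divide_less_eq)
    ultimately have "N < real a * (real a + 1)" by (simp add: algebra_simps)
    also have "\<dots> < (real a + 1 / 2)\<^sup>2" by (simp add: power2_eq_square algebra_simps)
    finally have "sqrt N < real a + 1 / 2" using a by (intro real_less_lsqrt) auto
    then show ?thesis by simp
  qed
  have "(\<Sum>a\<in>A. 1 / real a) \<le> (\<Sum>a\<in>A. ln (1 + 1 / real a) + 1 / (real a)\<^sup>2 / 2)"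
  proof (rule sum_mono)
    fix a assume "a \<in> A"
    then show "1 / real a \<le> ln (1 + 1 / real a) + 1 / (real a)\<^sup>2 / 2"
      using ln_add_one_ge_quadratic[of "1 / real a"] by (simp add: power_divide)
  qed
  also have "\<dots> = (\<Sum>a\<in>A. ln (1 + 1 / real a)) + (\<Sum>a\<in>A. 1 / (real a)\<^sup>2) / 2"
    by (simp add: sum.distrib sum_divide_distrib)
  also have "\<dots> \<le> 1 / u + 1 / N + 1 / (sqrt N - 1) / 2"
    by (intro add_mono ln_le divide_right_mono sum_inverse_squares_le fin rt big) auto
  \<comment> \<open>The quadratic error used one half of \<open>1 / (sqrt N - 1)\<close>; the term
    \<open>1 / N\<close> fits into the other half.\<close>
  also have "1 / N \<le> 1 / (sqrt N - 1) / 2"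
  proof -
    have "0 \<le> (sqrt N - 1)\<^sup>2" by simp
    also have "\<dots> = N + 1 - 2 * sqrt N" using assms(3) by (simp add: power2_diff)
    finally have "2 * (sqrt N - 1) \<le> N" by simp
    then have "1 / N \<le> 1 / (2 * (sqrt N - 1))" using rt assms(3) by (intro frac_le) auto
    then show ?thesis by (simp add: mult.commute)
  qed
  finally have "(\<Sum>a\<in>A. 1 / real a) \<le> 1 / u + 1 / (sqrt N - 1)"
    by (simp only: add.assoc field_sum_of_halves)
  then show False using assms(5) by simp
qed

end
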